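(* If $G$ is a connected locally finite graph with one end and linear growth, then the automorphism group of $G$ is either finite or contains exactly $2^{\aleph_0}$ many elements.
   Context: Ends: rays are one-way infinite paths; two rays are in the same end if for every finite vertex set $S$ they have tails in the same component of $G-S$; ends are the equivalence classes. For a vertex $v$, $B_v(n)$ denotes the set of vertices at distance at most $n$ from $v$. A connected locally finite graph has linear growth if there is a constant $c$ such that $|B_v(n)|\le cn$ for all $n=1,2,\ldots$ (this property does not depend on the choice of $v$). *)

theory Defs
  imports
    "Graph_Theory.Graph_Theory"
    "HOL-Algebra.Bij"
    "HOL-Library.Equipollence"
begin

text \<open>
  A (possibly infinite) simple graph is a \<open>pair_bidirected_digraph\<close>: an irreflexive, symmetric
  adjacency relation \<open>parcs G\<close> on the vertex set \<open>pverts G\<close>. The locale \<open>pair_graph\<close> is not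
  used, since it additionally requires finiteness.
\<close>

definition locally_finite :: "'a pair_pre_digraph \<Rightarrow> bool" where
  "locally_finite G \<longleftrightarrow> (\<forall>v \<in> pverts G. finite (out_arcs (with_proj G) v))"

text \<open>In a symmetric digraph the strongly connected components are the components.\<close>

definition components_minus :: "'a pair_pre_digraph \<Rightarrow> 'a set \<Rightarrow> 'a set set" where
  "components_minus G S = pre_digraph.sccs_verts (with_proj G \<restriction> (pverts G - S))"

definition ray :: "'a pair_pre_digraph \<Rightarrow> (nat \<Rightarrow> 'a) \<Rightarrow> bool" where
  "ray G r \<longleftrightarrow> inj r \<and> (\<forall>i. (r i, r (Suc i)) \<in> parcs G)"

definition has_tail_in :: "(nat \<Rightarrow> 'a) \<Rightarrow> 'a set \<Rightarrow> bool" where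
  "has_tail_in r C \<longleftrightarrow> (\<exists>m. \<forall>i\<ge>m. r i \<in> C)"

definition same_end :: "'a pair_pre_digraph \<Rightarrow> ((nat \<Rightarrow> 'a) \<times> (nat \<Rightarrow> 'a)) set" where
  "same_end G = {(r, s). ray G r \<and> ray G s \<and>
     (\<forall>S. finite S \<and> S \<subseteq> pverts G \<longrightarrow>
        (\<exists>C \<in> components_minus G S. has_tail_in r C \<and> has_tail_in s C))}"

lemma equiv_same_end:
  assumes "pair_bidirected_digraph G"
  shows "equiv {r. ray G r} (same_end G)"
proof -
  interpret pair_bidirected_digraph G by fact
  have wfH: "wf_digraph (with_proj G \<restriction> (pverts G - S))" for S
    using wellformed_induce_subgraph by simp
  have tail: "\<exists>C \<in> components_minus G S. has_tail_in r C"
    if r: "ray G r" and S: "finite S" for r S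
  proof -
    let ?H = "with_proj G \<restriction> (pverts G - S)"
    interpret H: wf_digraph ?H by (rule wfH)
    have inj: "inj r" and adj: "\<And>i. (r i, r (Suc i)) \<in> parcs G"
      using r by (auto simp: ray_def)
    have symG: "sym (parcs G)"
      using pair_sym_arcs by (simp add: symmetric_def)
    have "finite (r -` S)"
      using S inj by (rule finite_vimageI)
    then obtain m where m: "\<And>i. r i \<in> S \<Longrightarrow> i < m"
      using finite_nat_set_iff_bounded by (metis vimageI)
    have notS: "r i \<in> pverts G - S" if "i \<ge> m" for i
      using m[of i] that adj[of i] in_arcsD1 by auto
    have step: "r i \<rightarrow>\<^bsub>?H\<^esub> r (Suc i)" "r (Suc i) \<rightarrow>\<^bsub>?H\<^esub> r i" if "i \<ge> m" for i
      using notS[of i] notS[of "Suc i"] adj[of i] symD[OF symG adj[of i]] that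
      by (auto simp: arcs_ends_def arc_to_ends_def image_iff)
    have reach: "r m \<rightarrow>\<^sup>*\<^bsub>?H\<^esub> r i \<and> r i \<rightarrow>\<^sup>*\<^bsub>?H\<^esub> r m" if "i \<ge> m" for i
      using that
    proof (induction i rule: dec_induct)
      case base
      then show ?case using notS[of m] by simp
    next
      case (step n)
      then show ?case
        using \<open>\<And>i. i \<ge> m \<Longrightarrow> r i \<rightarrow>\<^bsub>?H\<^esub> r (Suc i)\<close> \<open>\<And>i. i \<ge> m \<Longrightarrow> r (Suc i) \<rightarrow>\<^bsub>?H\<^esub> r i\<close>
        by (meson H.adj_reachable_trans H.reachable_adj_trans)
    qed
    have "H.scc_of (r m) \<in> components_minus G S"
      unfolding components_minus_def using notS[of m] by (intro H.scc_of_in_sccs_verts) simp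
    moreover have "has_tail_in r (H.scc_of (r m))"
      unfolding has_tail_in_def using reach by (auto simp: H.scc_of_def)
    ultimately show ?thesis by blast
  qed
  show ?thesis
  proof (rule equivI)
    show "same_end G \<subseteq> {r. ray G r} \<times> {r. ray G r}"
      by (auto simp: same_end_def)
    show "refl_on {r. ray G r} (same_end G)"
      using tail by (auto simp: refl_on_def same_end_def)
    show "sym (same_end G)"
      by (rule symI) (auto simp: same_end_def)
    show "trans (same_end G)"
    proof (rule transI)
      fix r s t assume rs: "(r, s) \<in> same_end G" and st: "(s, t) \<in> same_end G"
      have "\<exists>C \<in> components_minus G S. has_tail_in r C \<and> has_tail_in t C"
        if S: "finite S" "S \<subseteq> pverts G" for S
      proof -
        interpret H: wf_digraph "with_proj G \<restriction> (pverts G - S)" by (rule wfH)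
        obtain C where C: "C \<in> components_minus G S" "has_tail_in r C" "has_tail_in s C"
          using rs S unfolding same_end_def by auto
        obtain D where D: "D \<in> components_minus G S" "has_tail_in s D" "has_tail_in t D"
          using st S unfolding same_end_def by auto
        obtain n k where "\<forall>i\<ge>n. s i \<in> C" "\<forall>i\<ge>k. s i \<in> D"
          using C(3) D(2) unfolding has_tail_in_def by auto
        then have "s (max n k) \<in> C \<inter> D"
          by simp
        then have "C = D"
          using H.sccs_verts_disjoint[of C D] C(1) D(1) unfolding components_minus_def by auto
        with C D(3) show ?thesis by auto
      qed
      moreover have "ray G r" "ray G t"
        using rs st unfolding same_end_def by simp_all
      ultimately show "(r, t) \<in> same_end G"
        unfolding same_end_def by simp
    qed
  qed
qed

definition graph_ends :: "'a pair_pre_digraph \<Rightarrow> (nat \<Rightarrow> 'a) set set" where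
  "graph_ends G = {r. ray G r} // same_end G"

definition graph_dist :: "'a pair_pre_digraph \<Rightarrow> 'a \<Rightarrow> 'a \<Rightarrow> ereal" where
  "graph_dist G = wf_digraph.\<mu> (with_proj G) (\<lambda>_. 1)"

definition graph_ball :: "'a pair_pre_digraph \<Rightarrow> 'a \<Rightarrow> nat \<Rightarrow> 'a set" where
  "graph_ball G v n = {w \<in> pverts G. graph_dist G v w \<le> ereal (real n)}"

lemma graph_ball_conv_awalk:
  assumes "pair_wf_digraph G" and "v \<in> pverts G"
  shows "graph_ball G v n = {w. \<exists>p. pre_digraph.awalk (with_proj G) v p w \<and> length p \<le> n}"
proof -
  interpret pair_wf_digraph G by fact
  have cost: "awalk_cost (\<lambda>_. 1) p = real (length p)" for p :: "('a \<times> 'a) awalk"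
    by (induction p) auto
  have "graph_dist G v w \<le> ereal (real n) \<longleftrightarrow> (\<exists>p. awalk v p w \<and> length p \<le> n)" for w
  proof
    assume le: "graph_dist G v w \<le> ereal (real n)"
    show "\<exists>p. awalk v p w \<and> length p \<le> n"
    proof (rule ccontr)
      assume "\<not> ?thesis"
      then have "real n + 1 \<le> real (length p)" if "awalk v p w" for p
        using that by (metis Suc_leI add.commute not_le of_nat_Suc of_nat_le_iff)
      then have "ereal (real n + 1) \<le> graph_dist G v w"
        unfolding graph_dist_def \<mu>_def cost by (intro INF_greatest) auto
      with le have "ereal (real n + 1) \<le> ereal (real n)"
        by (rule order_trans[rotated])
      then show False by simp
    qed
  next
    assume "\<exists>p. awalk v p w \<and> length p \<le> n"
    then obtain p where "awalk v p w" "length p \<le> n" by blast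
    then show "graph_dist G v w \<le> ereal (real n)"
      unfolding graph_dist_def \<mu>_def cost by (intro INF_lower2[of p]) auto
  qed
  moreover have "w \<in> pverts G" if "awalk v p w" for p w
    using that awalk_last_in_verts by simp
  ultimately show ?thesis
    by (auto simp: graph_ball_def)
qed

text \<open>
  Finiteness of the balls is automatic in a locally finite graph; it is required explicitly because
  \<^const>\<open>card\<close> is 0 on infinite sets.
\<close>

definition linear_growth :: "'a pair_pre_digraph \<Rightarrow> bool" where
  "linear_growth G \<longleftrightarrow> (\<exists>v \<in> pverts G. \<exists>c::real. \<forall>n\<ge>1.
     finite (graph_ball G v n) \<and> real (card (graph_ball G v n)) \<le> c * real n)"

text \<open>
  As in \<^const>\<open>BijGroup\<close>, automorphisms are extensional functions on the vertex set, so that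
  distinct elements differ on some vertex.
\<close>

definition graph_auts :: "'a pair_pre_digraph \<Rightarrow> ('a \<Rightarrow> 'a) set" where
  "graph_auts G = {f \<in> Bij (pverts G).
     \<forall>u \<in> pverts G. \<forall>v \<in> pverts G. (u, v) \<in> parcs G \<longleftrightarrow> (f u, f v) \<in> parcs G}"

definition GraphAutGroup :: "'a pair_pre_digraph \<Rightarrow> ('a \<Rightarrow> 'a) monoid" where
  "GraphAutGroup G = BijGroup (pverts G) \<lparr>carrier := graph_auts G\<rparr>"

lemma group_GraphAutGroup: "group (GraphAutGroup G)"
  unfolding GraphAutGroup_def
proof (rule subgroup.subgroup_is_group[OF _ group_BijGroup], rule subgroup.intro)
  show "graph_auts G \<subseteq> carrier (BijGroup (pverts G))"
    by (auto simp: graph_auts_def BijGroup_def)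
  show "x \<otimes>\<^bsub>BijGroup (pverts G)\<^esub> y \<in> graph_auts G"
    if "x \<in> graph_auts G" "y \<in> graph_auts G" for x y
  proof -
    have "y u \<in> pverts G" if "u \<in> pverts G" for u
      using \<open>y \<in> graph_auts G\<close> that Bij_imp_funcset by (auto simp: graph_auts_def)
    then show ?thesis
      using that by (auto simp: graph_auts_def BijGroup_def compose_Bij compose_eq)
  qed
  show "\<one>\<^bsub>BijGroup (pverts G)\<^esub> \<in> graph_auts G"
    by (auto simp: graph_auts_def BijGroup_def id_Bij)
  show "inv\<^bsub>BijGroup (pverts G)\<^esub> x \<in> graph_auts G" if x: "x \<in> graph_auts G" for x
  proof -
    have B: "x \<in> Bij (pverts G)" using x by (simp add: graph_auts_def)
    have "x (inv_into (pverts G) x u) = u" "inv_into (pverts G) x u \<in> pverts G"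
      if "u \<in> pverts G" for u
      using B that by (auto simp: Bij_def bij_betw_inv_into_right Bij_inv_into_mem[OF B])
    then show ?thesis
      using x B by (auto simp: graph_auts_def inv_BijGroup restrict_inv_into_Bij)
  qed
qed

end

theory Submission
  imports Defs
begin

text \<open>
  Write \<open>A\<close> for the automorphism group. There are two cases.

  If every finite vertex set is fixed pointwise by a nontrivial automorphism, choose automorphisms
  \<open>f\<^sub>0, f\<^sub>1, \<dots>\<close> such that \<open>f\<^sub>k\<close> fixes a ball of radius \<open>r\<^sub>k\<close> around a vertex \<open>v\<close> but moves a
  vertex of the ball of radius \<open>r\<^sub>k\<^sub>+\<^sub>1\<close>. For every set \<open>B\<close> of natural numbers the product of the
  \<open>f\<^sub>k\<close> with \<open>k \<in> B\<close>, in which factors with larger index are applied first, converges: on each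
  ball around \<open>v\<close> its partial products are eventually constant. The limits are automorphisms, and
  different \<open>B\<close> give different automorphisms
  (\<open>nat_sets_lepoll_auts\<close>). Since the vertex set is countable, \<open>A\<close> has the cardinality of the
  continuum. One-endedness and growth play no role here.

  Otherwise some finite set \<open>S\<close> has trivial pointwise stabilizer, and \<open>A\<close> has to be finite
  (\<open>finite_auts_if_trivial_stabilizer\<close>). Let \<open>\<partial>X\<close> be the set of vertices of \<open>X\<close> that have a
  neighbour outside \<open>X\<close>. Three facts are combined.

  (1) By linear growth there are spheres of bounded size of arbitrarily large radius, so every
  finite set lies in a finite set \<open>D\<close> with \<open>\<bar>\<partial>D\<bar> \<le> c\<close>, for a constant \<open>c\<close>. Let \<open>k\<close> be the least
  such constant. Then some finite \<open>T\<close> satisfies \<open>\<bar>\<partial>D\<bar> \<ge> k\<close> for all finite \<open>D \<supseteq> T\<close>.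

  (2) The function \<open>\<bar>\<partial>X\<bar>\<close> is submodular. Hence, if \<open>X\<close> and \<open>gX\<close> both contain \<open>T\<close> and
  \<open>\<bar>\<partial>X\<bar> \<le> k\<close>, then \<open>\<bar>\<partial>(X \<union> gX)\<bar> \<le> k\<close>.

  (3) By one-endedness, the finite sets \<open>X\<close> whose boundary has at most \<open>k\<close> elements, all of them in
  a fixed union of finitely many \<open>A\<close>-orbits, have bounded size (\<open>finite_cut_card_bounded\<close>).
  Indeed, around a boundary vertex \<open>p\<close> there are disjoint barriers \<open>Z\<^sub>0, Z\<^sub>1, \<dots>\<close>, each of which cannot
  be split by \<open>X\<close> without meeting \<open>\<partial>X\<close>. One of the first \<open>k + 1\<close> barriers misses \<open>\<partial>X\<close>, and then
  the bounded region inside it can be added to \<open>X\<close> or removed from \<open>X\<close>, so that \<open>p\<close> is no longer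
  a boundary vertex and no new one appears; now use induction on \<open>\<bar>\<partial>X\<bar>\<close>. The bounds depend on \<open>p\<close>
  only up to automorphisms.

  Suppose that \<open>A\<close> is infinite and choose a set \<open>F\<close> of more than \<open>k ^ k\<close> automorphisms. By (1)
  there is a finite \<open>D\<close> with \<open>\<bar>\<partial>D\<bar> \<le> k\<close> that contains \<open>S\<close>, \<open>T\<close> and the preimages of \<open>T\<close> under
  the members of \<open>F\<close>. Among the finite sets \<open>X \<supseteq> D\<close> with \<open>\<bar>\<partial>X\<bar> \<le> k\<close> and boundary in the orbits of
  \<open>D\<close> there is a largest one by (3), and by (2) it is invariant under every \<open>g \<in> F\<close>. By the
  pigeonhole principle two members \<open>f \<noteq> g\<close> of \<open>F\<close> agree on \<open>\<partial>X\<close>. The automorphism \<open>h\<close> obtained by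
  applying \<open>f\<close> and then the inverse of \<open>g\<close> fixes \<open>\<partial>X\<close> pointwise and is nontrivial on \<open>S \<subseteq> X\<close>, so
  \<open>h\<close> on \<open>X\<close> and the identity elsewhere form a nontrivial automorphism with finite support. As \<open>A\<close>
  is infinite, some conjugate of it has its support outside \<open>S\<close>, which contradicts the choice of
  \<open>S\<close>.
\<close>

section \<open>Infinite connected locally finite graphs\<close>

text \<open>
  A graph is given by its vertex set \<open>V\<close> and its symmetric edge relation \<open>E\<close>. The vertex set is
  assumed to be infinite, which is the only case in which there is an end.
\<close>

locale connected_lf_graph =
  fixes V :: "'a set" and E :: "'a rel"
  assumes edge_verts: "E \<subseteq> V \<times> V"
    and sym_edges: "sym E"
    and finite_nbrs: "v \<in> V \<Longrightarrow> finite (E `` {v})"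
    and connected: "u \<in> V \<Longrightarrow> v \<in> V \<Longrightarrow> (u, v) \<in> E\<^sup>*"
    and infinite_verts: "infinite V"
begin

lemma finite_nbrs_set: "finite X \<Longrightarrow> X \<subseteq> V \<Longrightarrow> finite (E `` X)"
  using finite_nbrs by (subst Image_eq_UN) auto

text \<open>
  The inner vertex boundary: all edges between \<open>X\<close> and its complement start in \<open>boundary X\<close>. With
  this choice an automorphism that preserves \<open>X\<close> and fixes \<open>boundary X\<close> pointwise can be changed to
  the identity outside \<open>X\<close>.
\<close>

definition boundary :: "'a set \<Rightarrow> 'a set" where
  "boundary X = {x \<in> X. \<exists>y. (x, y) \<in> E \<and> y \<notin> X}"

lemma boundary_subset: "boundary X \<subseteq> X"
  unfolding boundary_def by blast

lemma card_boundary_submodular: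
  assumes "finite X" "finite Y"
  shows "card (boundary (X \<inter> Y)) + card (boundary (X \<union> Y)) \<le> card (boundary X) + card (boundary Y)"
proof -
  have fin: "finite (boundary Z)" if "finite Z" for Z
    using boundary_subset that by (rule finite_subset)
  have "card (boundary (X \<inter> Y)) + card (boundary (X \<union> Y))
      = card (boundary (X \<inter> Y) \<union> boundary (X \<union> Y)) + card (boundary (X \<inter> Y) \<inter> boundary (X \<union> Y))"
    using fin assms by (intro card_Un_Int) auto
  also have "\<dots> \<le> card (boundary X \<union> boundary Y) + card (boundary X \<inter> boundary Y)"
  proof (rule add_mono; rule card_mono)
    show "finite (boundary X \<union> boundary Y)" "finite (boundary X \<inter> boundary Y)"
      using fin assms by auto
  qed (auto simp: boundary_def)
  also have "\<dots> = card (boundary X) + card (boundary Y)"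
    using fin assms by (intro card_Un_Int[symmetric]) auto
  finally show ?thesis .
qed

lemma boundary_empty_imp_empty:
  assumes X: "finite X" "X \<subseteq> V" and empty: "boundary X = {}"
  shows "X = {}"
proof (rule ccontr)
  assume "X \<noteq> {}"
  then obtain x where x: "x \<in> X" by blast
  have "y \<in> X" if "(x, y) \<in> E\<^sup>*" for y
    using that
  proof (induction rule: rtrancl_induct)
    case (step y z)
    then show ?case using empty by (auto simp: boundary_def)
  qed (use x in simp)
  then have "V \<subseteq> X"
    using connected x X(2) by blast
  then show False
    using infinite_verts X(1) finite_subset by blast
qed

text \<open>
  The ball \<open>ball v n\<close> consists of the endpoints of the walks of length at most \<open>n\<close> from \<open>v\<close>.
\<close>

primrec ball :: "'a \<Rightarrow> nat \<Rightarrow> 'a set" where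
  "ball v 0 = {v}"
| "ball v (Suc n) = ball v n \<union> E `` ball v n"

lemma ball_subset_verts: "v \<in> V \<Longrightarrow> ball v n \<subseteq> V"
  by (induction n) (use edge_verts in auto)

lemma finite_ball: "v \<in> V \<Longrightarrow> finite (ball v n)"
  by (induction n) (simp_all add: finite_nbrs_set ball_subset_verts)

lemma ball_mono: "m \<le> n \<Longrightarrow> ball v m \<subseteq> ball v n"
  by (rule lift_Suc_mono_le[of "ball v"]) auto

lemma in_some_ball:
  assumes "v \<in> V" "u \<in> V"
  shows "\<exists>n. u \<in> ball v n"
  using connected[OF assms]
proof (induction rule: rtrancl_induct)
  case base
  have "v \<in> ball v 0" by simp
  then show ?case by blast
next
  case (step y z)
  then obtain n where "y \<in> ball v n" by blast
  with step have "z \<in> ball v (Suc n)" by auto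
  then show ?case by blast
qed

lemma finite_subset_ball:
  assumes v: "v \<in> V" and "finite S" "S \<subseteq> V"
  shows "\<exists>n. S \<subseteq> ball v n"
  using assms(2,3)
proof (induction rule: finite_induct)
  case (insert x S)
  then obtain n where "S \<subseteq> ball v n" by auto
  moreover obtain m where "x \<in> ball v m"
    using in_some_ball v insert by blast
  ultimately have "insert x S \<subseteq> ball v (max m n)"
    using ball_mono[of m "max m n" v] ball_mono[of n "max m n" v] by auto
  then show ?case by blast
qed simp

lemma boundary_ball_Suc: "boundary (ball v (Suc n)) \<subseteq> ball v (Suc n) - ball v n"
  by (auto simp: boundary_def)

text \<open>
  If all balls around \<open>v\<close> of radius at least \<open>m\<close> had a boundary of more than \<open>c\<close> vertices, then
  the ball of radius \<open>m + k\<close> would have at least \<open>k * (c + 1)\<close> vertices, which exceeds the bound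
  \<open>c * (m + k)\<close> for large \<open>k\<close>.
\<close>

lemma linear_growth_imp_bounded_cuts:
  assumes v: "v \<in> V" and growth: "\<And>n. n \<ge> 1 \<Longrightarrow> card (ball v n) \<le> c * n"
    and T: "finite T" "T \<subseteq> V"
  shows "\<exists>D. finite D \<and> T \<subseteq> D \<and> D \<subseteq> V \<and> card (boundary D) \<le> c"
proof (rule ccontr)
  assume none: "\<not> ?thesis"
  obtain m where m: "T \<subseteq> ball v m"
    using finite_subset_ball v T by blast
  have big: "c + 1 \<le> card (boundary (ball v n))" if "n \<ge> m" for n
  proof (rule ccontr)
    assume "\<not> ?thesis"
    then have "card (boundary (ball v n)) \<le> c" by simp
    moreover have "T \<subseteq> ball v n" using m ball_mono[OF that] by blast
    ultimately show False
      using none finite_ball[OF v] ball_subset_verts[OF v] by blast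
  qed
  have "k * (c + 1) \<le> card (ball v (m + k))" for k
  proof (induction k)
    case (Suc k)
    have "card (boundary (ball v (Suc (m + k)))) \<le> card (ball v (Suc (m + k)) - ball v (m + k))"
      by (rule card_mono[OF _ boundary_ball_Suc]) (use finite_ball[OF v] in blast)
    also have "\<dots> = card (ball v (Suc (m + k))) - card (ball v (m + k))"
      by (rule card_Diff_subset) (use finite_ball[OF v] in auto)
    finally have "c + 1 \<le> card (ball v (Suc (m + k))) - card (ball v (m + k))"
      using big[of "Suc (m + k)"] by linarith
    with Suc show ?case by simp
  qed simp
  \<comment> \<open>The value \<open>k = m * c + 1\<close> is the least one with \<open>k * (c + 1) > c * (m + k)\<close>.\<close>
  from order_trans[OF this growth, of "m * c + 1"] have "(m * c + 1) * (c + 1) \<le> c * (m + (m * c + 1))"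
    by simp
  then show False by (simp add: algebra_simps)
qed

section \<open>Components of the complement of a vertex set\<close>

text \<open>
  Two vertices are linked outside \<open>T\<close> if they are joined by a path that avoids \<open>T\<close>. By reflexivity
  every vertex is linked to itself, even in \<open>T\<close>. For \<open>x\<close> outside \<open>T\<close>, the component of \<open>x\<close> in the
  graph minus \<open>T\<close> is \<open>linked T `` {x}\<close>.
\<close>

definition linked :: "'a set \<Rightarrow> 'a rel" where
  "linked T = (E \<inter> (- T) \<times> (- T))\<^sup>*"

lemma linked_refl: "(x, x) \<in> linked T"
  by (simp add: linked_def)

lemma linked_edge: "(x, y) \<in> E \<Longrightarrow> x \<notin> T \<Longrightarrow> y \<notin> T \<Longrightarrow> (x, y) \<in> linked T"
  by (auto simp: linked_def)

lemma linked_trans: "(x, y) \<in> linked T \<Longrightarrow> (y, z) \<in> linked T \<Longrightarrow> (x, z) \<in> linked T"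
  by (simp add: linked_def)

lemma linked_sym: "(x, y) \<in> linked T \<Longrightarrow> (y, x) \<in> linked T"
  unfolding linked_def
  by (rule symD[OF sym_rtrancl]) (use sym_edges in \<open>auto simp: sym_def\<close>)

text \<open>
  A path from \<open>x\<close> can be shortened to one that never returns to \<open>x\<close>.
\<close>

lemma last_exit:
  assumes "(x, z) \<in> linked Q" "z \<noteq> x"
  shows "\<exists>y. (x, y) \<in> E \<and> y \<notin> insert x Q \<and> (y, z) \<in> linked (insert x Q)"
  using assms unfolding linked_def
proof (induction rule: rtrancl_induct)
  case (step u z)
  show ?case
  proof (cases "u = x")
    case True
    with step show ?thesis by auto
  next
    case False
    then obtain y where y: "(x, y) \<in> E" "y \<notin> insert x Q"
        "(y, u) \<in> (E \<inter> (- insert x Q) \<times> (- insert x Q))\<^sup>*"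
      using step by blast
    have "(u, z) \<in> E \<inter> (- insert x Q) \<times> (- insert x Q)"
      using step False by auto
    with y show ?thesis
      by (meson rtrancl.rtrancl_into_rtrancl)
  qed
qed simp

lemma infinite_component_step:
  assumes "x \<in> V" and inf: "infinite (linked Q `` {x})"
  shows "\<exists>y. (x, y) \<in> E \<and> y \<notin> insert x Q \<and> infinite (linked (insert x Q) `` {y})"
proof (rule ccontr)
  assume "\<not> ?thesis"
  then have "finite (\<Union>y \<in> E `` {x} - insert x Q. linked (insert x Q) `` {y})"
    using finite_nbrs assms(1) by auto
  moreover have "linked Q `` {x} \<subseteq> insert x (\<Union>y \<in> E `` {x} - insert x Q. linked (insert x Q) `` {y})"
    using last_exit by fastforce
  ultimately show False
    using inf finite_subset by blast
qed

text \<open>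
  Koenig's lemma. The state of the construction consists of the set \<open>Q\<close> of forbidden vertices,
  which are those of \<open>T\<close> and the vertices already used, and of the current vertex, whose component
  outside \<open>Q\<close> is kept infinite.
\<close>

lemma ray_in_infinite_component:
  assumes x: "x \<in> V" "x \<notin> T" and inf: "infinite (linked T `` {x})"
  shows "\<exists>r. inj r \<and> (\<forall>i. (r i, r (Suc i)) \<in> E) \<and> (\<forall>i. (x, r i) \<in> linked T)"
proof -
  let ?P = "\<lambda>(n::nat) s. (n = 0 \<longrightarrow> s = (T, x)) \<and> snd s \<in> V \<and> snd s \<notin> fst s \<and> infinite (linked (fst s) `` {snd s})"
  let ?R = "\<lambda>(n::nat) s s'. (snd s, snd s') \<in> E \<and> fst s' = insert (snd s) (fst s)"
  have "\<exists>f. \<forall>n. ?P n (f n) \<and> ?R n (f n) (f (Suc n))"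
  proof (rule dependent_nat_choice)
    show "\<exists>s. ?P 0 s"
      using x inf by auto
  next
    fix s and n :: nat assume s: "?P n s"
    then obtain y where y: "(snd s, y) \<in> E" "y \<notin> insert (snd s) (fst s)"
        "infinite (linked (insert (snd s) (fst s)) `` {y})"
      using infinite_component_step by blast
    show "\<exists>s'. ?P (Suc n) s' \<and> ?R n s s'"
      by (rule exI[of _ "(insert (snd s) (fst s), y)"]) (use y edge_verts in auto)
  qed
  then obtain f where P: "\<And>n. ?P n (f n)" and R: "\<And>n. ?R n (f n) (f (Suc n))"
    by blast
  define r where "r i = snd (f i)" for i
  define Q where "Q i = fst (f i)" for i
  have start: "r 0 = x" "Q 0 = T" using P[of 0] by (auto simp: r_def Q_def)
  have out: "r i \<notin> Q i" and Q_Suc: "Q (Suc i) = insert (r i) (Q i)"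
    and edge: "(r i, r (Suc i)) \<in> E" for i
    using P[of i] R[of i] by (auto simp: r_def Q_def)
  have Q_mono: "Q i \<subseteq> Q j" if "i \<le> j" for i j
    using that by (rule lift_Suc_mono_le[of Q, rotated]) (use Q_Suc in auto)
  have "r i \<noteq> r j" if "i < j" for i j
    using Q_mono[of "Suc i" j] that Q_Suc[of i] out[of j] by auto
  then have "inj r"
    by (metis injI linorder_neqE_nat)
  moreover have notT: "r i \<notin> T" for i
    using out[of i] Q_mono[of 0 i] start by auto
  have "(x, r i) \<in> linked T" for i
  proof (induction i)
    case 0
    then show ?case using start linked_refl by simp
  next
    case (Suc i)
    then show ?case using linked_edge[OF edge notT notT] linked_trans by blast
  qed
  ultimately show ?thesis using edge by blast
qed

lemma linked_from_nbr:
  assumes "t \<in> T" "T \<subseteq> V" "x \<in> V" "x \<notin> T"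
  shows "\<exists>y \<in> E `` T - T. (y, x) \<in> linked T"
proof -
  have "x \<notin> T \<longrightarrow> (\<exists>y \<in> E `` T - T. (y, x) \<in> linked T)" if "(t, x) \<in> E\<^sup>*" for x
    using that
  proof (induction rule: rtrancl_induct)
    case base
    then show ?case using assms(1) by simp
  next
    case (step y z)
    then show ?case
      using linked_refl linked_edge linked_trans by (metis DiffI ImageI)
  qed
  then show ?thesis using connected assms by blast
qed

text \<open>
  The vertices of a path from \<open>x\<close> to \<open>z\<close> form such a set \<open>P\<close>: a set \<open>X\<close> that contains only one of
  the two endpoints has a boundary vertex on the path.
\<close>

lemma linked_barrier:
  assumes "(x, z) \<in> linked T" "x \<in> V" "x \<notin> T"
  shows "\<exists>P. finite P \<and> P \<subseteq> V - T \<and> (\<forall>X. boundary X \<inter> P = {} \<longrightarrow> (x \<in> X \<longleftrightarrow> z \<in> X))"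
  using assms(1) unfolding linked_def
proof (induction rule: rtrancl_induct)
  case base
  then show ?case by blast
next
  case (step y z)
  then obtain P where P: "finite P" "P \<subseteq> V - T"
      "\<And>X. boundary X \<inter> P = {} \<Longrightarrow> (x \<in> X \<longleftrightarrow> y \<in> X)"
    by blast
  have e: "(y, z) \<in> E" "(z, y) \<in> E" and "y \<notin> T" "z \<notin> T"
    using step(2) sym_edges by (auto dest: symD)
  show ?case
  proof (intro exI[of _ "P \<union> {y, z}"] conjI allI impI)
    show "P \<union> {y, z} \<subseteq> V - T"
      using P e edge_verts \<open>y \<notin> T\<close> \<open>z \<notin> T\<close> by auto
    fix X assume X: "boundary X \<inter> (P \<union> {y, z}) = {}"
    then have "y \<notin> boundary X" "z \<notin> boundary X" by blast+
    then have "y \<in> X \<longleftrightarrow> z \<in> X"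
      using e unfolding boundary_def by blast
    moreover have "boundary X \<inter> P = {}" using X by blast
    ultimately show "x \<in> X \<longleftrightarrow> z \<in> X" using P(3)[of X] by simp
  qed (use P in simp)
qed

end

section \<open>One-ended graphs\<close>

text \<open>
  For all rays \<open>r\<close> and \<open>s\<close> and all finite sets \<open>T\<close>, some vertex of \<open>r\<close> and some vertex of \<open>s\<close>
  are linked outside \<open>T\<close>, so there is at most one end. The existence of a ray need not be assumed,
  since it follows from Koenig's lemma.
\<close>

locale one_ended_graph = connected_lf_graph +
  assumes rays_linked: "finite T \<Longrightarrow> T \<subseteq> V \<Longrightarrow>
    inj r \<Longrightarrow> (\<And>i. (r i, r (Suc i)) \<in> E) \<Longrightarrow> inj s \<Longrightarrow> (\<And>i. (s i, s (Suc i)) \<in> E) \<Longrightarrow>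
    \<exists>i j. (r i, s j) \<in> linked T"
begin

text \<open>
  Filling in the finite components of the complement of \<open>T\<close> leaves a single component, since
  two infinite components would contain rays of different ends. Each component contains a
  neighbour of \<open>T\<close>, so there are only finitely many of them.
\<close>

lemma finite_hull:
  assumes T: "finite T" "T \<subseteq> V" "T \<noteq> {}"
  shows "\<exists>U. finite U \<and> T \<subseteq> U \<and> U \<subseteq> V \<and> (\<forall>y \<in> V - U. \<forall>z \<in> V - U. (y, z) \<in> linked T)"
proof -
  define U where "U = T \<union> {x \<in> V - T. finite (linked T `` {x})}"
  have "U \<subseteq> T \<union> (\<Union>y \<in> {y \<in> E `` T - T. finite (linked T `` {y})}. linked T `` {y})"
  proof
    fix x assume x: "x \<in> U"
    show "x \<in> T \<union> (\<Union>y \<in> {y \<in> E `` T - T. finite (linked T `` {y})}. linked T `` {y})"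
    proof (cases "x \<in> T")
      case False
      then have xV: "x \<in> V" and fin: "finite (linked T `` {x})"
        using x by (auto simp: U_def)
      obtain y where y: "y \<in> E `` T - T" "(y, x) \<in> linked T"
        using linked_from_nbr T xV False by blast
      then have "linked T `` {y} \<subseteq> linked T `` {x}"
        using linked_sym linked_trans by blast
      then have "finite (linked T `` {y})"
        using fin finite_subset by blast
      with y show ?thesis by blast
    qed simp
  qed
  moreover have "finite (E `` T)"
    using finite_nbrs_set T by blast
  ultimately have "finite U"
    using T(1) by (elim finite_subset) auto
  moreover have "(y, z) \<in> linked T" if y: "y \<in> V - U" and z: "z \<in> V - U" for y z
  proof -
    obtain r where r: "inj r" "\<And>i. (r i, r (Suc i)) \<in> E" "\<And>i. (y, r i) \<in> linked T"
      using ray_in_infinite_component[of y T] y by (auto simp: U_def)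
    obtain s where s: "inj s" "\<And>i. (s i, s (Suc i)) \<in> E" "\<And>i. (z, s i) \<in> linked T"
      using ray_in_infinite_component[of z T] z by (auto simp: U_def)
    obtain i j where "(r i, s j) \<in> linked T"
      using rays_linked[OF T(1,2) r(1,2) s(1,2)] by blast
    then show ?thesis
      using r(3)[of i] s(3)[of j] linked_sym linked_trans by blast
  qed
  moreover have "T \<subseteq> U" "U \<subseteq> V"
    using T by (auto simp: U_def)
  ultimately show ?thesis by blast
qed

text \<open>
  Outside the finite set \<open>U\<close> around \<open>T\<close>, the neighbours of \<open>U\<close> are joined by paths that avoid \<open>T\<close>;
  the barrier \<open>Z\<close> is the union of such paths. If \<open>Z\<close> misses the boundary of \<open>X\<close>, then the
  neighbours of \<open>U\<close> are all in \<open>X\<close> or all outside \<open>X\<close>. Accordingly, \<open>U\<close> can be added to \<open>X\<close> or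
  removed from \<open>X\<close> without creating a boundary vertex.
\<close>

lemma absorb_if_disjoint_barrier:
  assumes T: "finite T" "T \<subseteq> V" "T \<noteq> {}"
  shows "\<exists>U Z. finite U \<and> T \<subseteq> U \<and> U \<subseteq> V \<and> finite Z \<and> Z \<subseteq> V - T \<and>
    (\<forall>X. finite X \<and> X \<subseteq> V \<and> boundary X \<inter> Z = {} \<longrightarrow>
      (\<exists>X'. finite X' \<and> X' \<subseteq> V \<and> boundary X' \<subseteq> boundary X - U \<and> X \<subseteq> X' \<union> U))"
proof -
  obtain U where U: "finite U" "T \<subseteq> U" "U \<subseteq> V"
    and conn: "\<And>y z. y \<in> V - U \<Longrightarrow> z \<in> V - U \<Longrightarrow> (y, z) \<in> linked T"
    using finite_hull[OF T] by metis
  define N where "N = E `` U - U"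
  have N: "finite N" "N \<subseteq> V - U"
    using finite_nbrs_set U edge_verts by (auto simp: N_def)
  have "\<forall>p \<in> N \<times> N. \<exists>P. finite P \<and> P \<subseteq> V - T \<and>
      (\<forall>X. boundary X \<inter> P = {} \<longrightarrow> (fst p \<in> X \<longleftrightarrow> snd p \<in> X))"
  proof
    fix p assume "p \<in> N \<times> N"
    then have p: "fst p \<in> V - U" "snd p \<in> V - U"
      using N by auto
    show "\<exists>P. finite P \<and> P \<subseteq> V - T \<and>
        (\<forall>X. boundary X \<inter> P = {} \<longrightarrow> (fst p \<in> X \<longleftrightarrow> snd p \<in> X))"
      using linked_barrier[OF conn[OF p]] p U(2) by blast
  qed
  from bchoice[OF this] obtain P where P: "\<forall>p \<in> N \<times> N. finite (P p) \<and> P p \<subseteq> V - T \<and>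
      (\<forall>X. boundary X \<inter> P p = {} \<longrightarrow> (fst p \<in> X \<longleftrightarrow> snd p \<in> X))"
    by (elim exE) (rule that)
  define Z where "Z = (\<Union>p \<in> N \<times> N. P p)"
  have Z: "finite Z" "Z \<subseteq> V - T"
    using P N unfolding Z_def by (blast intro: finite_SigmaI)+
  have "\<exists>X'. finite X' \<and> X' \<subseteq> V \<and> boundary X' \<subseteq> boundary X - U \<and> X \<subseteq> X' \<union> U"
    if X: "finite X" "X \<subseteq> V" "boundary X \<inter> Z = {}" for X
  proof -
    have "y \<in> X \<longleftrightarrow> z \<in> X" if "y \<in> N" "z \<in> N" for y z
    proof -
      have yz: "(y, z) \<in> N \<times> N" using that by simp
      then have "boundary X \<inter> P (y, z) = {}"
        using X(3) unfolding Z_def by blast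
      then show ?thesis using bspec[OF P yz] by simp
    qed
    then consider "N \<subseteq> X" | "N \<inter> X = {}" by blast
    then show ?thesis
    proof cases
      case 1
      then have "boundary (X \<union> U) \<subseteq> boundary X - U"
        by (auto simp: boundary_def N_def)
      then show ?thesis
        using X U by (intro exI[of _ "X \<union> U"]) auto
    next
      case 2
      then have "boundary (X - U) \<subseteq> boundary X - U"
        using sym_edges by (auto simp: boundary_def N_def dest: symD)
      then show ?thesis
        using X U by (intro exI[of _ "X - U"]) auto
    qed
  qed
  then show ?thesis
    using U Z by (intro exI[of _ U] exI[of _ Z]) simp
qed

text \<open>
  If the barrier around \<open>T\<close> meets the boundary of \<open>X\<close>, then fewer boundary vertices lie outside the
  larger set \<open>U \<union> Z\<close>, so the barrier around that set can be tried next. The bound \<open>M\<close> on the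
  modification of \<open>X\<close> depends only on \<open>T\<close> and \<open>c\<close>.
\<close>

lemma absorb:
  assumes "finite T" "T \<subseteq> V" "T \<noteq> {}"
  shows "\<exists>M. finite M \<and> (\<forall>X. finite X \<and> X \<subseteq> V \<and> card (boundary X - T) \<le> c \<longrightarrow>
      (\<exists>X'. finite X' \<and> X' \<subseteq> V \<and> boundary X' \<subseteq> boundary X - T \<and> X \<subseteq> X' \<union> M))"
  using assms
proof (induction c arbitrary: T)
  case 0
  obtain U Z where UZ: "finite U" "T \<subseteq> U" "U \<subseteq> V" "finite Z" "Z \<subseteq> V - T"
    "\<forall>X. finite X \<and> X \<subseteq> V \<and> boundary X \<inter> Z = {} \<longrightarrow>
      (\<exists>X'. finite X' \<and> X' \<subseteq> V \<and> boundary X' \<subseteq> boundary X - U \<and> X \<subseteq> X' \<union> U)"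
    using absorb_if_disjoint_barrier[OF 0] by (elim exE conjE) (rule that)
  have "\<exists>X'. finite X' \<and> X' \<subseteq> V \<and> boundary X' \<subseteq> boundary X - T \<and> X \<subseteq> X' \<union> U"
    if X: "finite X" "X \<subseteq> V" "card (boundary X - T) \<le> 0" for X
  proof -
    have "boundary X \<subseteq> T"
      using X finite_subset[OF boundary_subset] by auto
    then have "boundary X \<inter> Z = {}" using UZ(5) by auto
    then obtain X' where "finite X'" "X' \<subseteq> V" "boundary X' \<subseteq> boundary X - U" "X \<subseteq> X' \<union> U"
      using UZ(6)[rule_format, of X] X(1,2) by auto
    then show ?thesis using UZ(2) by (intro exI[of _ X']) blast
  qed
  then show ?case using UZ(1) by blast
next
  case (Suc c)
  obtain U Z where UZ: "finite U" "T \<subseteq> U" "U \<subseteq> V" "finite Z" "Z \<subseteq> V - T"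
    "\<forall>X. finite X \<and> X \<subseteq> V \<and> boundary X \<inter> Z = {} \<longrightarrow>
      (\<exists>X'. finite X' \<and> X' \<subseteq> V \<and> boundary X' \<subseteq> boundary X - U \<and> X \<subseteq> X' \<union> U)"
    using absorb_if_disjoint_barrier[OF Suc.prems] by (elim exE conjE) (rule that)
  have "finite (U \<union> Z)" "U \<union> Z \<subseteq> V" "U \<union> Z \<noteq> {}"
    using UZ Suc.prems by auto
  from Suc.IH[OF this] obtain M where M: "finite M"
    "\<forall>X. finite X \<and> X \<subseteq> V \<and> card (boundary X - (U \<union> Z)) \<le> c \<longrightarrow>
      (\<exists>X'. finite X' \<and> X' \<subseteq> V \<and> boundary X' \<subseteq> boundary X - (U \<union> Z) \<and> X \<subseteq> X' \<union> M)"
    by (elim exE conjE) (rule that)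
  have "\<exists>X'. finite X' \<and> X' \<subseteq> V \<and> boundary X' \<subseteq> boundary X - T \<and> X \<subseteq> X' \<union> (U \<union> M)"
    if X: "finite X" "X \<subseteq> V" "card (boundary X - T) \<le> Suc c" for X
  proof (cases "boundary X \<inter> Z = {}")
    case True
    then obtain X' where "finite X'" "X' \<subseteq> V" "boundary X' \<subseteq> boundary X - U" "X \<subseteq> X' \<union> U"
      using UZ(6)[rule_format, of X] X(1,2) by auto
    then show ?thesis using UZ(2) by (intro exI[of _ X']) blast
  next
    case False
    then have "boundary X - (U \<union> Z) \<subset> boundary X - T"
      using UZ(2,5) by blast
    moreover have "finite (boundary X - T)"
      using X(1) finite_subset[OF boundary_subset] by blast
    ultimately have "card (boundary X - (U \<union> Z)) < card (boundary X - T)"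
      by (rule psubset_card_mono[rotated])
    then have "card (boundary X - (U \<union> Z)) \<le> c" using X(3) by linarith
    then obtain X' where "finite X'" "X' \<subseteq> V" "boundary X' \<subseteq> boundary X - (U \<union> Z)" "X \<subseteq> X' \<union> M"
      using M(2)[rule_format, of X] X(1,2) by auto
    then show ?thesis using UZ(2) by (intro exI[of _ X']) blast
  qed
  then show ?case using UZ(1) M(1) by (intro exI[of _ "U \<union> M"]) simp
qed

end

section \<open>Automorphisms\<close>

context connected_lf_graph
begin

text \<open>
  The automorphisms, as extensional functions on \<open>V\<close>. In particular \<open>\<lambda>x\<in>V. x\<close> is the identity and
  \<open>compose V\<close> is the composition.
\<close>

definition auts :: "('a \<Rightarrow> 'a) set" where
  "auts = {f \<in> Bij V. \<forall>u \<in> V. \<forall>v \<in> V. (u, v) \<in> E \<longleftrightarrow> (f u, f v) \<in> E}"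

lemma autsI:
  assumes "f \<in> extensional V" "inj_on f V" "f ` V = V"
    and "\<And>u v. u \<in> V \<Longrightarrow> v \<in> V \<Longrightarrow> (u, v) \<in> E \<longleftrightarrow> (f u, f v) \<in> E"
  shows "f \<in> auts"
  using assms by (simp add: auts_def Bij_def bij_betw_def)

lemma auts_props:
  assumes "f \<in> auts"
  shows auts_extensional: "f \<in> extensional V"
    and auts_inj: "inj_on f V"
    and auts_image: "f ` V = V"
    and auts_edge: "u \<in> V \<Longrightarrow> v \<in> V \<Longrightarrow> (f u, f v) \<in> E \<longleftrightarrow> (u, v) \<in> E"
    and auts_verts: "u \<in> V \<Longrightarrow> f u \<in> V"
  using assms by (auto simp: auts_def Bij_def bij_betw_def)

lemma auts_eqI: "f \<in> auts \<Longrightarrow> g \<in> auts \<Longrightarrow> (\<And>x. x \<in> V \<Longrightarrow> f x = g x) \<Longrightarrow> f = g"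
  by (rule extensionalityI[OF auts_extensional auts_extensional])

lemma id_auts: "(\<lambda>x\<in>V. x) \<in> auts"
  by (rule autsI) (auto simp: inj_on_def)

lemma compose_auts:
  assumes f: "f \<in> auts" and g: "g \<in> auts"
  shows "compose V f g \<in> auts"
proof -
  have "compose V f g \<in> Bij V"
    using f g by (auto simp: auts_def intro: compose_Bij)
  then show ?thesis
    using auts_edge[OF f] auts_edge[OF g] auts_verts[OF g]
    by (simp add: auts_def compose_eq)
qed

lemma inverse_auts:
  assumes f: "f \<in> auts"
  shows "\<exists>g \<in> auts. (\<forall>x \<in> V. g (f x) = x) \<and> (\<forall>x \<in> V. f (g x) = x)"
proof
  let ?g = "\<lambda>x\<in>V. inv_into V f x"
  have gV: "inv_into V f x \<in> V" and fg: "f (inv_into V f x) = x" if "x \<in> V" for x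
    using auts_image[OF f] that by (auto intro: inv_into_into f_inv_into_f)
  have gf: "inv_into V f (f x) = x" if "x \<in> V" for x
    using auts_inj[OF f] that by (rule inv_into_f_f)
  show "(\<forall>x \<in> V. ?g (f x) = x) \<and> (\<forall>x \<in> V. f (?g x) = x)"
    using gV fg gf auts_verts[OF f] by simp
  have "?g \<in> Bij V"
    using f by (auto simp: auts_def intro: restrict_inv_into_Bij)
  moreover have "(u, v) \<in> E \<longleftrightarrow> (inv_into V f u, inv_into V f v) \<in> E" if "u \<in> V" "v \<in> V" for u v
    using auts_edge[OF f gV[OF that(1)] gV[OF that(2)]] fg that by simp
  ultimately show "?g \<in> auts"
    by (simp add: auts_def)
qed

lemma boundary_auts_image:
  assumes f: "f \<in> auts" and X: "X \<subseteq> V"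
  shows "boundary (f ` X) = f ` boundary X"
proof
  show "boundary (f ` X) \<subseteq> f ` boundary X"
  proof
    fix y assume "y \<in> boundary (f ` X)"
    then obtain x z where x: "x \<in> X" "y = f x" and z: "(f x, z) \<in> E" "z \<notin> f ` X"
      unfolding boundary_def by blast
    then obtain w where w: "w \<in> V" "z = f w"
      using auts_image[OF f] edge_verts by blast
    then have "(x, w) \<in> E" "w \<notin> X"
      using auts_edge[OF f, of x w] x z X by auto
    then show "y \<in> f ` boundary X"
      using x unfolding boundary_def by blast
  qed
  show "f ` boundary X \<subseteq> boundary (f ` X)"
  proof
    fix y assume "y \<in> f ` boundary X"
    then obtain x w where x: "x \<in> X" "y = f x" and w: "(x, w) \<in> E" "w \<notin> X"
      unfolding boundary_def by blast
    have V: "x \<in> V" "w \<in> V" using w edge_verts by auto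
    then have "(f x, f w) \<in> E" using auts_edge[OF f] w by blast
    moreover have "f w \<notin> f ` X"
      using inj_on_image_mem_iff[OF auts_inj[OF f] V(2) X] w by simp
    ultimately show "y \<in> boundary (f ` X)"
      using x unfolding boundary_def by blast
  qed
qed

lemma auts_ball:
  assumes f: "f \<in> auts" and v: "v \<in> V"
  shows "f ` ball v n \<subseteq> ball (f v) n"
proof (induction n)
  case (Suc n)
  have "f w \<in> E `` ball (f v) n" if "u \<in> ball v n" "(u, w) \<in> E" for u w
  proof -
    have "u \<in> V" "w \<in> V" using that edge_verts by auto
    then have "(f u, f w) \<in> E" using auts_edge[OF f] that by blast
    then show ?thesis using Suc that(1) by blast
  qed
  with Suc show ?case by auto
qed simp

text \<open>
  Replacing an automorphism by the identity outside an invariant set whose boundary it fixes.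
\<close>

lemma cut_and_paste_auts:
  assumes g: "g \<in> auts" and X: "X \<subseteq> V" "g ` X = X"
    and fix_bd: "\<And>x. x \<in> boundary X \<Longrightarrow> g x = x"
  shows "(\<lambda>x\<in>V. if x \<in> X then g x else x) \<in> auts"
proof (rule autsI)
  let ?h = "\<lambda>x\<in>V. if x \<in> X then g x else x"
  have gX: "g x \<in> X" if "x \<in> X" for x using X(2) that by blast
  have across: "(u, v) \<in> E \<longleftrightarrow> (g u, v) \<in> E" if u: "u \<in> X" and v: "v \<in> V" "v \<notin> X" for u v
  proof
    assume "(u, v) \<in> E"
    then have "u \<in> boundary X" using u v unfolding boundary_def by blast
    then show "(g u, v) \<in> E" using fix_bd \<open>(u, v) \<in> E\<close> by simp
  next
    assume e: "(g u, v) \<in> E"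
    then have "g u \<in> boundary X" using gX[OF u] v unfolding boundary_def by blast
    then have "g (g u) = g u" by (rule fix_bd)
    then have "g u = u"
      using inj_onD[OF auts_inj[OF g]] gX u X(1) by blast
    then show "(u, v) \<in> E" using e by simp
  qed
  show "(u, v) \<in> E \<longleftrightarrow> (?h u, ?h v) \<in> E" if uv: "u \<in> V" "v \<in> V" for u v
  proof (cases "u \<in> X"; cases "v \<in> X")
    assume "u \<in> X" "v \<in> X"
    then show ?thesis using auts_edge[OF g] uv by simp
  next
    assume "u \<in> X" "v \<notin> X"
    then show ?thesis using across uv by simp
  next
    assume "u \<notin> X" "v \<in> X"
    then show ?thesis using across[of v u] uv sym_edges
      by simp (metis symD)
  qed (use uv in simp)
  have "?h ` V = g ` X \<union> (V - X)"
    using X(1) by (auto simp: image_iff)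
  then show "?h ` V = V"
    using X by auto
  show "inj_on ?h V"
  proof (rule inj_onI)
    fix x y assume xy: "x \<in> V" "y \<in> V" "?h x = ?h y"
    then have "x \<in> X \<longleftrightarrow> y \<in> X" using gX by (auto split: if_splits)
    then show "x = y"
      using xy inj_onD[OF auts_inj[OF g]] by (auto split: if_splits)
  qed
qed simp

text \<open>
  An automorphism is determined by its values on \<open>S\<close>, and if it maps \<open>x\<close> to \<open>y\<close>, these values lie
  in a fixed ball around \<open>y\<close>.
\<close>

lemma finite_transporter:
  assumes S: "finite S" "S \<subseteq> V"
    and triv: "\<And>f. f \<in> auts \<Longrightarrow> (\<And>s. s \<in> S \<Longrightarrow> f s = s) \<Longrightarrow> f = (\<lambda>x\<in>V. x)"
    and x: "x \<in> V" "y \<in> V"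
  shows "finite {f \<in> auts. f x = y}"
proof -
  obtain n where n: "S \<subseteq> ball x n" using finite_subset_ball[OF x(1) S] by blast
  have "inj_on (\<lambda>f. restrict f S) {f \<in> auts. f x = y}"
  proof (rule inj_onI)
    fix f g assume f: "f \<in> {f \<in> auts. f x = y}" and g: "g \<in> {f \<in> auts. f x = y}"
      and eq: "restrict f S = restrict g S"
    obtain h where h: "h \<in> auts" "\<And>x. x \<in> V \<Longrightarrow> h (g x) = x" "\<And>x. x \<in> V \<Longrightarrow> g (h x) = x"
      using inverse_auts g by blast
    have "f s = g s" if "s \<in> S" for s
      using fun_cong[OF eq, of s] that by simp
    then have "compose V h f = (\<lambda>x\<in>V. x)"
      using h S f by (intro triv compose_auts) (auto simp: compose_eq)
    then have "h (f x) = x" if "x \<in> V" for x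
      using that by (metis compose_eq restrict_apply')
    then have "f x = g x" if "x \<in> V" for x
      using h(3)[of "f x"] auts_verts f that by fastforce
    then show "f = g" using f g by (intro auts_eqI) auto
  qed
  moreover have "(\<lambda>f. restrict f S) ` {f \<in> auts. f x = y} \<subseteq> S \<rightarrow>\<^sub>E ball y n"
    using auts_ball x n by fastforce
  moreover have "finite (S \<rightarrow>\<^sub>E ball y n)"
    using S(1) finite_ball[OF x(2)] by (intro finite_PiE)
  ultimately show ?thesis
    by (meson finite_imageD finite_subset)
qed

text \<open>
  Since \<open>auts\<close> is infinite, some \<open>a \<in> auts\<close> maps \<open>S\<close> off the set \<open>X\<close>, which
  contains the support of \<open>h\<close>. Then the conjugate of \<open>h\<close> by \<open>a\<close> fixes \<open>S\<close> pointwise.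
\<close>

lemma no_finite_support_auts:
  assumes S: "finite S" "S \<subseteq> V"
    and triv: "\<And>f. f \<in> auts \<Longrightarrow> (\<And>s. s \<in> S \<Longrightarrow> f s = s) \<Longrightarrow> f = (\<lambda>x\<in>V. x)"
    and inf: "infinite auts"
    and h: "h \<in> auts" and X: "finite X" "X \<subseteq> V" "\<And>x. x \<in> V - X \<Longrightarrow> h x = x"
  shows "h = (\<lambda>x\<in>V. x)"
proof -
  have "finite (\<Union>x \<in> X. \<Union>s \<in> S. {f \<in> auts. f s = x})"
    using finite_transporter[OF S triv] S X by (intro finite_UN_I) auto
  then have "\<not> auts \<subseteq> (\<Union>x \<in> X. \<Union>s \<in> S. {f \<in> auts. f s = x})"
    using inf by (metis (no_types) finite_subset)
  then obtain a where a: "a \<in> auts" "a \<notin> (\<Union>x \<in> X. \<Union>s \<in> S. {f \<in> auts. f s = x})"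
    unfolding subset_iff by (simp only: not_all not_imp) (elim exE conjE, rule that)
  obtain b where b: "b \<in> auts" "\<And>x. x \<in> V \<Longrightarrow> b (a x) = x" "\<And>x. x \<in> V \<Longrightarrow> a (b x) = x"
    using inverse_auts a(1) by blast
  have "compose V b (compose V h a) = (\<lambda>x\<in>V. x)"
  proof (rule triv)
    show "compose V b (compose V h a) \<in> auts" using a b h by (intro compose_auts) auto
    fix s assume s: "s \<in> S"
    then have "a s \<in> V - X" using a S auts_verts by blast
    then show "compose V b (compose V h a) s = s"
      using X(3) s S b by (auto simp: compose_eq)
  qed
  then have bha: "b (h (a x)) = x" if "x \<in> V" for x
    using that by (metis compose_eq restrict_apply')
  have "h x = x" if x: "x \<in> V" for x
  proof -
    have bx: "b x \<in> V" using auts_verts b x by blast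
    have "b (h x) = b x" using bha[OF bx] b(3)[OF x] by simp
    then show ?thesis
      using inj_onD[OF auts_inj[OF b(1)]] auts_verts[OF h] x by blast
  qed
  then show ?thesis using h id_auts by (intro auts_eqI) auto
qed

lemma auts_orbit_invariant:
  assumes g: "g \<in> auts" and D: "D \<subseteq> V"
  shows "g ` (\<Union>a \<in> auts. a ` D) \<subseteq> (\<Union>a \<in> auts. a ` D)"
proof -
  have "g (f d) \<in> (\<Union>a \<in> auts. a ` D)" if f: "f \<in> auts" and d: "d \<in> D" for f d
  proof -
    have "g (f d) = compose V g f d" using d D by (auto simp: compose_eq)
    then show ?thesis using compose_auts[OF g f] d by blast
  qed
  then show ?thesis by blast
qed

end

section \<open>A trivial stabilizer forces finiteness\<close>

context one_ended_graph
begin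

text \<open>
  Induction on \<open>c\<close>: a boundary vertex of \<open>X\<close> is moved into \<open>D\<close> by an automorphism \<open>b\<close> and then
  removed from the boundary of \<open>b ` X\<close> by \<open>absorb\<close>, at the cost of finitely many vertices.
\<close>

lemma finite_cut_card_bounded:
  assumes D: "finite D" "D \<subseteq> V"
  shows "\<exists>N. \<forall>X. finite X \<and> X \<subseteq> V \<and> boundary X \<subseteq> (\<Union>a \<in> auts. a ` D) \<and> card (boundary X) \<le> c \<longrightarrow>
    card X \<le> N"
proof (induction c)
  case 0
  have "card X \<le> 0" if "finite X" "X \<subseteq> V" "card (boundary X) \<le> 0" for X
    using that boundary_empty_imp_empty[of X] finite_subset[OF boundary_subset, of X] by auto
  then show ?case by blast
next
  case (Suc c)
  let ?Y = "\<Union>a \<in> auts. a ` D"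
  obtain N where N: "\<forall>X. finite X \<and> X \<subseteq> V \<and> boundary X \<subseteq> ?Y \<and> card (boundary X) \<le> c \<longrightarrow> card X \<le> N"
    using Suc by blast
  have "\<forall>p \<in> D. \<exists>M. finite M \<and> (\<forall>X. finite X \<and> X \<subseteq> V \<and> card (boundary X - {p}) \<le> c \<longrightarrow>
      (\<exists>X'. finite X' \<and> X' \<subseteq> V \<and> boundary X' \<subseteq> boundary X - {p} \<and> X \<subseteq> X' \<union> M))"
    using D(2) by (intro ballI absorb) auto
  from bchoice[OF this] obtain M where M: "\<forall>p \<in> D. finite (M p) \<and>
      (\<forall>X. finite X \<and> X \<subseteq> V \<and> card (boundary X - {p}) \<le> c \<longrightarrow>
      (\<exists>X'. finite X' \<and> X' \<subseteq> V \<and> boundary X' \<subseteq> boundary X - {p} \<and> X \<subseteq> X' \<union> M p))"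
    by (elim exE) (rule that)
  have "card X \<le> N + (\<Sum>p\<in>D. card (M p))"
    if X: "finite X" "X \<subseteq> V" "boundary X \<subseteq> ?Y" "card (boundary X) \<le> Suc c" for X
  proof (cases "boundary X = {}")
    case True
    then have "X = {}" using boundary_empty_imp_empty X by blast
    then show ?thesis by simp
  next
    case False
    then obtain p a where p: "p \<in> D" and a: "a \<in> auts" "a p \<in> boundary X"
      using X(3) by blast
    obtain b where b: "b \<in> auts" "\<And>x. x \<in> V \<Longrightarrow> b (a x) = x" "\<And>x. x \<in> V \<Longrightarrow> a (b x) = x"
      using inverse_auts a(1) by blast
    have bd: "boundary (b ` X) = b ` boundary X"
      using boundary_auts_image b(1) X(2) .
    have fin: "finite (boundary X)"
      using X(1) boundary_subset finite_subset by blast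
    have p_in: "p \<in> b ` boundary X"
      using a(2) b(2)[of p] p D(2) by (metis image_eqI subsetD)
    have "card (b ` boundary X) \<le> Suc c"
      using card_image_le[OF fin] X(4) order_trans by blast
    then have le: "card (b ` boundary X - {p}) \<le> c"
      using p_in fin by simp
    moreover have bX: "finite (b ` X)" "b ` X \<subseteq> V"
      using X b auts_verts by auto
    ultimately obtain X' where X': "finite X'" "X' \<subseteq> V" "boundary X' \<subseteq> b ` boundary X - {p}" "b ` X \<subseteq> X' \<union> M p"
      using conjunct2[OF bspec[OF M p], rule_format, of "b ` X"] bd by auto
    have "b ` boundary X \<subseteq> ?Y"
      using image_mono[OF X(3)] auts_orbit_invariant[OF b(1) D(2)] by (rule order_trans)
    then have "boundary X' \<subseteq> ?Y"
      by (rule order_trans[OF order_trans[OF X'(3) Diff_subset]])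
    moreover have "card (boundary X') \<le> c"
      using card_mono[OF _ X'(3)] fin le by simp
    ultimately have "card X' \<le> N" using N X' by blast
    have "card X = card (b ` X)"
      using auts_inj[OF b(1)] X(2) by (metis card_image inj_on_subset)
    also have "\<dots> \<le> card (X' \<union> M p)"
      using X' M p by (intro card_mono) auto
    also have "\<dots> \<le> card X' + card (M p)" by (rule card_Un_le)
    also have "\<dots> \<le> N + (\<Sum>p\<in>D. card (M p))"
      using \<open>card X' \<le> N\<close> member_le_sum[OF p, of "\<lambda>p. card (M p)"] D(1) by simp
    finally show ?thesis .
  qed
  then show ?case by blast
qed

lemma finite_auts_if_trivial_stabilizer:
  assumes cuts: "\<And>T. finite T \<Longrightarrow> T \<subseteq> V \<Longrightarrow> \<exists>D. finite D \<and> T \<subseteq> D \<and> D \<subseteq> V \<and> card (boundary D) \<le> c"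
    and S: "finite S" "S \<subseteq> V"
    and triv: "\<And>f. f \<in> auts \<Longrightarrow> (\<And>s. s \<in> S \<Longrightarrow> f s = s) \<Longrightarrow> f = (\<lambda>x\<in>V. x)"
  shows "finite auts"
proof (rule ccontr)
  assume inf: "infinite auts"
  let ?P = "\<lambda>k. \<forall>T. finite T \<and> T \<subseteq> V \<longrightarrow> (\<exists>D. finite D \<and> T \<subseteq> D \<and> D \<subseteq> V \<and> card (boundary D) \<le> k)"
  \<comment> \<open>The least constant that bounds the boundaries of arbitrarily large finite sets.\<close>
  define k where "k = (LEAST k. ?P k)"
  have Pk: "?P k"
    unfolding k_def by (rule LeastI[of ?P c]) (use cuts in blast)
  obtain T where T: "finite T" "T \<subseteq> V"
    and T_min: "\<And>D. finite D \<Longrightarrow> T \<subseteq> D \<Longrightarrow> D \<subseteq> V \<Longrightarrow> k \<le> card (boundary D)"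
  proof (cases k)
    case 0
    then show ?thesis using that[of "{}"] by simp
  next
    case (Suc j)
    then have "\<not> ?P j"
      using not_less_Least[of j ?P] by (simp add: k_def)
    then obtain T where T: "finite T" "T \<subseteq> V"
      and none: "\<not> (\<exists>D. finite D \<and> T \<subseteq> D \<and> D \<subseteq> V \<and> card (boundary D) \<le> j)"
      by (simp only: not_all not_imp) (elim exE conjE, rule that)
    have "k \<le> card (boundary D)" if "finite D" "T \<subseteq> D" "D \<subseteq> V" for D
    proof (rule ccontr)
      assume "\<not> ?thesis"
      then have "card (boundary D) \<le> j" using Suc by simp
      then show False using none that by blast
    qed
    then show ?thesis using that[of T] T by blast
  qed
  obtain F where F: "F \<subseteq> auts" "finite F" "card F = Suc (k ^ k)"
    using infinite_arbitrarily_large[OF inf] by blast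
  \<comment> \<open>The preimages of \<open>T\<close> ensure that \<open>T \<subseteq> g ` X\<close> whenever \<open>X\<close> contains \<open>?T'\<close> and \<open>g \<in> F\<close>.\<close>
  let ?T' = "T \<union> S \<union> {x \<in> V. \<exists>g \<in> F. g x \<in> T}"
  have "finite {x \<in> V. \<exists>g \<in> F. g x \<in> T}"
  proof -
    have "finite {x \<in> V. g x \<in> T}" if "g \<in> F" for g
    proof (rule finite_imageD)
      show "finite (g ` {x \<in> V. g x \<in> T})"
        using T(1) by (rule finite_subset[rotated]) auto
      show "inj_on g {x \<in> V. g x \<in> T}"
        using auts_inj[of g] that F(1) by (auto simp: inj_on_def)
    qed
    moreover have "{x \<in> V. \<exists>g \<in> F. g x \<in> T} = (\<Union>g \<in> F. {x \<in> V. g x \<in> T})" by blast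
    ultimately show ?thesis using F(2) by simp
  qed
  then have "finite ?T' \<and> ?T' \<subseteq> V" using T S by auto
  from mp[OF spec[OF Pk] this]
  obtain D where D: "finite D" "?T' \<subseteq> D" "D \<subseteq> V" "card (boundary D) \<le> k"
    by (elim exE conjE) (rule that)
  let ?Y = "\<Union>a \<in> auts. a ` D"
  let ?C = "\<lambda>X. finite X \<and> D \<subseteq> X \<and> X \<subseteq> V \<and> boundary X \<subseteq> ?Y \<and> card (boundary X) \<le> k"
  obtain N where N: "\<forall>X. finite X \<and> X \<subseteq> V \<and> boundary X \<subseteq> ?Y \<and> card (boundary X) \<le> k \<longrightarrow> card X \<le> N"
    using finite_cut_card_bounded[OF D(1,3), of k] by (elim exE) (rule that)
  have "D \<subseteq> ?Y"
  proof
    fix x assume "x \<in> D"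
    then have "x = (\<lambda>x\<in>V. x) x" using D(3) by auto
    then show "x \<in> ?Y" using id_auts \<open>x \<in> D\<close> by blast
  qed
  with boundary_subset have "boundary D \<subseteq> ?Y" by (rule order_trans)
  then have "?C D" using D by simp
  moreover have "\<forall>X. ?C X \<longrightarrow> card X < Suc N" using N by (simp add: less_Suc_eq_le)
  ultimately have "\<exists>X. ?C X \<and> (\<forall>Z. ?C Z \<longrightarrow> card Z \<le> card X)"
    by (rule Lattices_Big.ex_has_greatest_nat)
  then obtain X where X: "?C X" and X_max: "\<forall>Z. ?C Z \<longrightarrow> card Z \<le> card X"
    by (elim exE conjE) (rule that, simp_all)
  \<comment> \<open>By submodularity \<open>X \<union> g ` X\<close> is again a candidate, so it equals \<open>X\<close> by maximality.\<close>
  have inv: "g ` X = X" if g: "g \<in> F" for g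
  proof -
    have gA: "g \<in> auts" using g F by blast
    have gX: "finite (g ` X)" "g ` X \<subseteq> V" using X auts_verts[OF gA] by auto
    have bd: "boundary (g ` X) = g ` boundary X"
      using boundary_auts_image gA X by blast
    have "T \<subseteq> g ` X"
    proof
      fix t assume t: "t \<in> T"
      then obtain x where "x \<in> V" "t = g x" using auts_image[OF gA] T by blast
      then have "x \<in> ?T'" using t g by blast
      then have "x \<in> X" using D(2) X by blast
      then show "t \<in> g ` X" using \<open>t = g x\<close> by blast
    qed
    then have "k \<le> card (boundary (X \<inter> g ` X))"
      using X D(2) by (intro T_min) auto
    moreover have "card (boundary (g ` X)) \<le> k"
      unfolding bd using X card_image_le[of "boundary X" g] finite_subset[OF boundary_subset, of X]
      by fastforce
    ultimately have "card (boundary (X \<union> g ` X)) \<le> k"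
      using card_boundary_submodular[of X "g ` X"] X gX(1) by linarith
    moreover have "boundary (X \<union> g ` X) \<subseteq> ?Y"
    proof -
      have bX: "boundary X \<subseteq> ?Y" using X by simp
      have "g ` boundary X \<subseteq> ?Y"
        using image_mono[OF bX] auts_orbit_invariant[OF gA D(3)] by (rule order_trans)
      moreover have "boundary (X \<union> g ` X) \<subseteq> boundary X \<union> boundary (g ` X)"
        unfolding boundary_def by blast
      ultimately show ?thesis using bX unfolding bd by (meson Un_least order_trans)
    qed
    ultimately have "?C (X \<union> g ` X)" using X gX by (simp add: le_supI1)
    then have "X \<union> g ` X = X"
      using X_max X gX by (intro card_seteq[symmetric]) auto
    moreover have "card (g ` X) = card X"
      using auts_inj[OF gA] X by (metis card_image inj_on_subset)
    ultimately show ?thesis using X by (metis Un_upper2 card_subset_eq)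
  qed
  let ?B = "boundary X"
  have XV: "finite X" "X \<subseteq> V" and SX: "S \<subseteq> X" and cardB: "card ?B \<le> k"
    using X D(2) by auto
  have finB: "finite ?B" using boundary_subset XV(1) by (rule finite_subset)
  \<comment> \<open>The members of \<open>F\<close> permute the boundary of \<open>X\<close>, which has at most \<open>k\<close> elements.\<close>
  have "card ((\<lambda>g. restrict g ?B) ` F) \<le> card (?B \<rightarrow>\<^sub>E ?B)"
  proof (rule card_mono)
    show "finite (?B \<rightarrow>\<^sub>E ?B)" using finB by (intro finite_PiE)
    have "g ` ?B = ?B" if "g \<in> F" for g
      using boundary_auts_image[OF subsetD[OF F(1) that] XV(2)] inv[OF that] by simp
    then have "g x \<in> ?B" if "g \<in> F" "x \<in> ?B" for g x
      using that by blast
    then show "(\<lambda>g. restrict g ?B) ` F \<subseteq> ?B \<rightarrow>\<^sub>E ?B" by auto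
  qed
  also have "\<dots> = card ?B ^ card ?B"
    using finB by (simp add: card_PiE)
  also have "\<dots> \<le> k ^ k"
  proof (cases "k = 0")
    case False
    have "card ?B ^ card ?B \<le> k ^ card ?B" using cardB by (intro power_mono) auto
    also have "\<dots> \<le> k ^ k" using cardB False by (intro power_increasing) auto
    finally show ?thesis .
  qed (use cardB in simp)
  finally have "card ((\<lambda>g. restrict g ?B) ` F) < card F" using F by simp
  then have "\<not> inj_on (\<lambda>g. restrict g ?B) F"
    using card_image by fastforce
  then obtain f g where fg: "f \<in> F" "g \<in> F" "f \<noteq> g" "restrict f ?B = restrict g ?B"
    by (auto simp: inj_on_def)
  have A: "f \<in> auts" "g \<in> auts" using fg F by auto
  obtain g' where g': "g' \<in> auts" "\<And>x. x \<in> V \<Longrightarrow> g' (g x) = x" "\<And>x. x \<in> V \<Longrightarrow> g (g' x) = x"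
    using inverse_auts A by blast
  define h where "h = compose V g' f"
  have h: "h \<in> auts" using compose_auts A g' by (simp add: h_def)
  have h_eq: "h x = g' (f x)" if "x \<in> V" for x using that by (simp add: h_def compose_eq)
  have g'X: "g' ` X = X"
  proof -
    have "g' ` g ` X = X" using g'(2) XV(2) by (force simp: image_image)
    then show ?thesis using inv[OF fg(2)] by simp
  qed
  have hX: "h ` X = X"
  proof -
    have "h ` X = g' ` f ` X" using XV(2) h_eq by (force simp: image_image)
    then show ?thesis using inv[OF fg(1)] g'X by simp
  qed
  have hB: "h x = x" if x: "x \<in> ?B" for x
  proof -
    have "x \<in> V" using x XV(2) boundary_subset by blast
    moreover have "f x = g x" using fun_cong[OF fg(4), of x] x by simp
    ultimately show ?thesis using h_eq g'(2) by simp
  qed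
  let ?h = "\<lambda>x\<in>V. if x \<in> X then h x else x"
  have eq: "?h = (\<lambda>x\<in>V. x)"
  proof (rule no_finite_support_auts[OF S triv inf])
    show "?h \<in> auts" using XV(2) by (intro cut_and_paste_auts h hX hB) auto
  qed (use XV in auto)
  then have "h s = s" if "s \<in> S" for s
  proof -
    have "?h s = (\<lambda>x\<in>V. x) s" by (simp only: eq)
    moreover have "s \<in> V" "s \<in> X" using that S(2) SX by blast+
    ultimately show ?thesis by simp
  qed
  then have "h = (\<lambda>x\<in>V. x)" using triv h by blast
  then have "g' (f x) = x" if "x \<in> V" for x using that h_eq[OF that] by simp
  then have "f x = g x" if "x \<in> V" for x
    using g'(3)[of "f x"] auts_verts[OF A(1)] that by fastforce
  then have "f = g" using A by (intro auts_eqI)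
  with fg show False by blast
qed

end

section \<open>Nontrivial stabilizers give a continuum of automorphisms\<close>

context connected_lf_graph
begin

lemma countable_verts: "countable V"
proof -
  obtain v where v: "v \<in> V" using infinite_verts by fastforce
  have "V = (\<Union>n. ball v n)"
    using in_some_ball[OF v] ball_subset_verts[OF v] by blast
  moreover have "countable (\<Union>n. ball v n)"
    using finite_ball[OF v] by (intro countable_UN) (auto intro: countable_finite)
  ultimately show ?thesis by simp
qed

lemma auts_lepoll: "auts \<lesssim> (UNIV :: nat set set)"
proof -
  let ?c = "to_nat_on V"
  have c: "inj_on ?c V" by (rule inj_on_to_nat_on[OF countable_verts])
  let ?F = "\<lambda>f. (\<lambda>x. prod_encode (?c x, ?c (f x))) ` V"
  have "inj_on ?F auts"
  proof (rule inj_onI)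
    fix f g assume f: "f \<in> auts" and g: "g \<in> auts" and eq: "?F f = ?F g"
    have "f x = g x" if x: "x \<in> V" for x
    proof -
      have "prod_encode (?c x, ?c (f x)) \<in> ?F g"
        unfolding eq[symmetric] using x by blast
      then obtain y where y: "y \<in> V" "?c x = ?c y" "?c (f x) = ?c (g y)"
        by auto
      then have "y = x" using inj_onD[OF c] x by metis
      then show ?thesis
        using inj_onD[OF c y(3)] auts_verts[OF f x] auts_verts[OF g x] by simp
    qed
    then show "f = g" using f g by (intro auts_eqI)
  qed
  then show ?thesis unfolding lepoll_def by blast
qed

lemma nat_sets_lepoll_auts:
  assumes nontriv: "\<And>S. finite S \<Longrightarrow> S \<subseteq> V \<Longrightarrow> \<exists>f \<in> auts. (\<forall>s \<in> S. f s = s) \<and> f \<noteq> (\<lambda>x\<in>V. x)"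
  shows "(UNIV :: nat set set) \<lesssim> auts"
proof -
  obtain v where v: "v \<in> V" using infinite_verts by fastforce
  have "\<forall>n. \<exists>q. fst q \<in> auts \<and> (\<forall>x \<in> ball v n. fst q x = x) \<and>
      (\<exists>x \<in> ball v (snd q). fst q x \<noteq> x)"
  proof
    fix n
    obtain f where f: "f \<in> auts" "\<forall>x \<in> ball v n. f x = x" "f \<noteq> (\<lambda>x\<in>V. x)"
      using nontriv[OF finite_ball[OF v] ball_subset_verts[OF v], of n] by blast
    have "\<exists>x \<in> V. f x \<noteq> x"
    proof (rule ccontr)
      assume "\<not> ?thesis"
      then have "f = (\<lambda>x\<in>V. x)" using f(1) id_auts by (intro auts_eqI) auto
      with f(3) show False by simp
    qed
    then obtain x where x: "x \<in> V" "f x \<noteq> x" by blast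
    obtain m where "x \<in> ball v m" using in_some_ball[OF v x(1)] by blast
    then show "\<exists>q. fst q \<in> auts \<and> (\<forall>x \<in> ball v n. fst q x = x) \<and>
        (\<exists>x \<in> ball v (snd q). fst q x \<noteq> x)"
      using f x by (intro exI[of _ "(f, m)"]) auto
  qed
  from choice[OF this] obtain q where q: "\<forall>n. fst (q n) \<in> auts \<and> (\<forall>x \<in> ball v n. fst (q n) x = x) \<and>
      (\<exists>x \<in> ball v (snd (q n)). fst (q n) x \<noteq> x)"
    by (elim exE) (rule that)
  \<comment> \<open>Radii such that \<open>f k\<close> fixes the ball of radius \<open>r k\<close> but not the one of radius \<open>r (Suc k)\<close>.\<close>
  define r where "r = rec_nat 0 (\<lambda>k rk. max (Suc rk) (snd (q rk)))"
  have r_Suc: "r (Suc k) = max (Suc (r k)) (snd (q (r k)))" for k by (simp add: r_def)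
  have r_mono: "r i \<le> r j" if "i \<le> j" for i j
    using that by (rule lift_Suc_mono_le[of r, rotated]) (simp add: r_Suc)
  have r_ge: "k \<le> r k" for k by (induction k) (auto simp: r_Suc)
  define f where "f k = fst (q (r k))" for k
  have f: "f k \<in> auts" for k using q by (simp add: f_def)
  have f_fix: "f k x = x" if "x \<in> ball v (r k)" for k x using q that by (simp add: f_def)
  have f_move: "\<exists>x \<in> ball v (r (Suc k)). f k x \<noteq> x" for k
    using q[rule_format, of "r k"] ball_mono[of "snd (q (r k))" "r (Suc k)" v]
    by (auto simp: f_def r_Suc)
  have ball_V: "x \<in> V" if "x \<in> ball v n" for x n
    using that ball_subset_verts[OF v] by blast
  \<comment> \<open>\<open>H B k\<close> is the product of the \<open>f j\<close> with \<open>j \<in> B\<close> and \<open>j < k\<close>. A new factor is applied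
    first, so that it does not affect the values on the ball of radius \<open>r k\<close>.\<close>
  define H where "H B = rec_nat (\<lambda>x\<in>V. x) (\<lambda>k h. if k \<in> B then compose V h (f k) else h)" for B :: "nat set"
  have H_0: "H B 0 = (\<lambda>x\<in>V. x)" for B by (simp add: H_def)
  have H_Suc: "H B (Suc k) = (if k \<in> B then compose V (H B k) (f k) else H B k)" for B k
    by (simp add: H_def)
  have H: "H B k \<in> auts" for B k
  proof (induction k)
    case 0
    show ?case unfolding H_0 by (rule id_auts)
  next
    case (Suc k)
    then show ?case using compose_auts[OF _ f] by (simp add: H_Suc)
  qed
  have H_stable: "H B j x = H B k x" if x: "x \<in> ball v (r k)" and "k \<le> j" for B j k x
    using that(2)
  proof (induction j rule: dec_induct)
    case (step j)
    have "x \<in> ball v (r j)" using ball_mono[OF r_mono] step(1) x by blast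
    then show ?case using step f_fix ball_V[OF x] by (simp add: H_Suc compose_eq)
  qed simp
  have H_v: "H B k v = v" for B k
    using H_stable[of v 0 k B] ball_mono[of 0 "r 0" v] v by (simp add: H_0)
  have in_ball: "\<exists>k. x \<in> ball v (r k)" if "x \<in> V" for x
    using in_some_ball[OF v that] ball_mono[OF r_ge] by blast
  define h where "h B = (\<lambda>x\<in>V. H B (LEAST k. x \<in> ball v (r k)) x)" for B
  have h_eq: "h B x = H B k x" if x: "x \<in> ball v (r k)" for B k x
    using H_stable[OF LeastI[of "\<lambda>k. x \<in> ball v (r k)", OF x] Least_le[of "\<lambda>k. x \<in> ball v (r k)", OF x], of B]
      ball_V[OF x] by (simp add: h_def)
  have common: "\<exists>k. x \<in> ball v (r k) \<and> y \<in> ball v (r k)" if xy: "x \<in> V" "y \<in> V" for x y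
  proof -
    obtain i j where "x \<in> ball v (r i)" "y \<in> ball v (r j)"
      using in_ball xy by blast
    then have "x \<in> ball v (r (max i j))" "y \<in> ball v (r (max i j))"
      using ball_mono[OF r_mono[of i "max i j"]] ball_mono[OF r_mono[of j "max i j"]] by auto
    then show ?thesis by blast
  qed
  \<comment> \<open>Surjectivity of the limit comes from the finiteness of the balls around the fixed vertex \<open>v\<close>.\<close>
  have H_ball: "H B k ` ball v n = ball v n" for B k n
    using auts_ball[OF H v, of B k n] finite_ball[OF v] inj_on_subset[OF auts_inj[OF H] ball_subset_verts[OF v]]
    by (intro endo_inj_surj) (simp_all add: H_v)
  have h_auts: "h B \<in> auts" for B
  proof (rule autsI)
    show "h B \<in> extensional V" by (simp add: h_def)
    show "inj_on (h B) V"
    proof (rule inj_onI)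
      fix x y assume xy: "x \<in> V" "y \<in> V" "h B x = h B y"
      then obtain k where "x \<in> ball v (r k)" "y \<in> ball v (r k)" using common by blast
      then show "x = y" using xy h_eq inj_onD[OF auts_inj[OF H]] by metis
    qed
    have h_ball: "h B ` ball v (r k) = ball v (r k)" for k
      using H_ball[of B k "r k"] h_eq by (metis (no_types, lifting) image_cong)
    show "h B ` V = V"
    proof
      show "h B ` V \<subseteq> V"
        using in_ball h_ball ball_V by blast
      show "V \<subseteq> h B ` V"
        using in_ball h_ball ball_V by blast
    qed
    fix x y assume xy: "x \<in> V" "y \<in> V"
    then obtain k where "x \<in> ball v (r k)" "y \<in> ball v (r k)" using common by blast
    then show "(x, y) \<in> E \<longleftrightarrow> (h B x, h B y) \<in> E"
      using auts_edge[OF H xy] h_eq by simp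
  qed
  \<comment> \<open>If \<open>k\<close> is the least number in which \<open>B\<close> and \<open>C\<close> differ, then exactly one of the products
    contains \<open>f k\<close>, and later factors are trivial on the ball of radius \<open>r (Suc k)\<close>.\<close>
  have diff_at: "h B \<noteq> h C" if k: "k \<in> B" "k \<notin> C" "\<And>j. j < k \<Longrightarrow> j \<in> B \<longleftrightarrow> j \<in> C" for B C k
  proof
    assume eq: "h B = h C"
    have same: "i \<le> k \<Longrightarrow> H B i = H C i" for i
      by (induction i) (simp_all add: H_0 H_Suc k(3))
    obtain x where x: "x \<in> ball v (r (Suc k))" "f k x \<noteq> x" using f_move by blast
    have xV: "x \<in> V" using ball_V x by blast
    have "H B k (f k x) = h B x"
      using h_eq[OF x(1), of B] k(1) xV by (simp add: H_Suc compose_eq)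
    also have "\<dots> = H B k x"
      using h_eq[OF x(1), of C] k(2) same[of k] eq by (simp add: H_Suc)
    finally have "f k x = x"
      using inj_onD[OF auts_inj[OF H]] auts_verts[OF f xV] xV by blast
    with x show False by blast
  qed
  have diff: "h B \<noteq> h C" if "B \<noteq> C" for B C
  proof -
    have "\<exists>k. (k \<in> B) \<noteq> (k \<in> C)" using that by blast
    then obtain k where k: "(k \<in> B) \<noteq> (k \<in> C)" and below: "\<forall>j<k. j \<in> B \<longleftrightarrow> j \<in> C"
      unfolding exists_least_iff[of "\<lambda>k. (k \<in> B) \<noteq> (k \<in> C)"] by auto
    from k consider "k \<in> B" "k \<notin> C" | "k \<in> C" "k \<notin> B" by blast
    then show ?thesis
    proof cases
      case 1
      show ?thesis by (rule diff_at[OF 1]) (use below in blast)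
    next
      case 2
      have "h C \<noteq> h B" by (rule diff_at[OF 2]) (use below in blast)
      then show ?thesis by (rule not_sym)
    qed
  qed
  then have "inj h" by (auto simp: inj_def)
  then show ?thesis unfolding lepoll_def using h_auts by blast
qed

end

section \<open>Transfer to the graph\<close>

lemma connected_imp_rtrancl:
  assumes "pair_bidirected_digraph G" "Digraph_Component.connected (with_proj G)"
    and "u \<in> pverts G" "v \<in> pverts G"
  shows "(u, v) \<in> (parcs G)\<^sup>*"
proof -
  interpret pair_bidirected_digraph G by fact
  have "strongly_connected (with_proj G)"
    using symmetric_connected_imp_strongly_connected[OF pair_sym_arcs assms(2)] .
  then have "u \<rightarrow>\<^sup>*\<^bsub>with_proj G\<^esub> v"
    using assms(3,4) by (auto simp: strongly_connected_def)
  then show ?thesis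
    unfolding reachable_def by (auto dest: rtrancl_on_rtranclI)
qed

lemma component_imp_rtrancl:
  assumes C: "C \<in> components_minus G S" and uv: "u \<in> C" "v \<in> C"
  shows "(u, v) \<in> (parcs G \<inter> (- S) \<times> (- S))\<^sup>*"
proof -
  let ?H = "with_proj G \<restriction> (pverts G - S)"
  have "u \<rightarrow>\<^sup>*\<^bsub>?H\<^esub> v"
    using C uv unfolding components_minus_def pre_digraph.sccs_verts_def by blast
  then have "(u, v) \<in> (arcs_ends ?H)\<^sup>*"
    unfolding reachable_def by (rule rtrancl_on_rtranclI)
  moreover have "arcs_ends ?H \<subseteq> parcs G \<inter> (- S) \<times> (- S)"
    by (auto simp: arcs_ends_def arc_to_ends_def)
  ultimately show ?thesis using rtrancl_mono by blast
qed

lemma same_end_if_single_end: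
  assumes G: "pair_bidirected_digraph G" and one: "card (graph_ends G) = 1"
    and r: "ray G r" and s: "ray G s"
  shows "(r, s) \<in> same_end G"
proof -
  obtain \<epsilon> where ends: "graph_ends G = {\<epsilon>}"
    using one by (rule card_1_singletonE)
  have "same_end G `` {r} \<in> graph_ends G" "same_end G `` {s} \<in> graph_ends G"
    using r s by (auto simp: graph_ends_def intro: quotientI)
  then have "same_end G `` {r} = same_end G `` {s}" using ends by simp
  then show ?thesis
    using eq_equiv_class[OF _ equiv_same_end[OF G]] s by blast
qed

lemma infinite_pverts_if_single_end:
  assumes G: "pair_bidirected_digraph G" and one: "card (graph_ends G) = 1"
  shows "infinite (pverts G)"
proof -
  interpret pair_bidirected_digraph G by fact
  have "{r. ray G r} \<noteq> {}"
  proof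
    assume "{r. ray G r} = {}"
    then have "graph_ends G = {}" by (simp add: graph_ends_def quotient_def)
    then show False using one by simp
  qed
  then obtain r where "ray G r" by blast
  then have "inj r" "range r \<subseteq> pverts G"
    using in_arcsD1 by (auto simp: ray_def)
  then show ?thesis
    using finite_subset range_inj_infinite by blast
qed

lemma connected_lf_graph_pverts:
  assumes G: "pair_bidirected_digraph G" and conn: "Digraph_Component.connected (with_proj G)"
    and lf: "locally_finite G" and inf: "infinite (pverts G)"
  shows "connected_lf_graph (pverts G) (parcs G)"
proof -
  interpret pair_bidirected_digraph G by fact
  show ?thesis
  proof
    show "parcs G \<subseteq> pverts G \<times> pverts G"
      using in_arcsD1 in_arcsD2 by auto
    show "sym (parcs G)"
      using pair_sym_arcs by (simp add: symmetric_def)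
    show "finite (parcs G `` {v})" if "v \<in> pverts G" for v
    proof -
      have "finite (out_arcs (with_proj G) v)"
        using lf that by (simp add: locally_finite_def)
      then have "finite (snd ` out_arcs (with_proj G) v)" by simp
      moreover have "parcs G `` {v} \<subseteq> snd ` out_arcs (with_proj G) v"
        by (force simp: out_arcs_def)
      ultimately show ?thesis by (rule finite_subset[rotated])
    qed
    show "(u, v) \<in> (parcs G)\<^sup>*" if "u \<in> pverts G" "v \<in> pverts G" for u v
      using connected_imp_rtrancl[OF G conn that] .
  qed (fact inf)
qed

lemma one_ended_graph_pverts:
  assumes G: "pair_bidirected_digraph G" and conn: "Digraph_Component.connected (with_proj G)"
    and lf: "locally_finite G" and one: "card (graph_ends G) = 1"
  shows "one_ended_graph (pverts G) (parcs G)"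
proof -
  interpret connected_lf_graph "pverts G" "parcs G"
    using connected_lf_graph_pverts[OF G conn lf infinite_pverts_if_single_end[OF G one]] .
  show ?thesis
  proof
    fix T and r s :: "nat \<Rightarrow> 'a"
    assume T: "finite T" "T \<subseteq> pverts G"
      and r: "inj r" "\<And>i. (r i, r (Suc i)) \<in> parcs G"
      and s: "inj s" "\<And>i. (s i, s (Suc i)) \<in> parcs G"
    have "(r, s) \<in> same_end G"
      using r s by (intro same_end_if_single_end[OF G one]) (auto simp: ray_def)
    then obtain C where C: "C \<in> components_minus G T" "has_tail_in r C" "has_tail_in s C"
      using T by (auto simp: same_end_def)
    then obtain i j where "r i \<in> C" "s j \<in> C"
      unfolding has_tail_in_def by blast
    then show "\<exists>i j. (r i, s j) \<in> linked T"
      using component_imp_rtrancl[OF C(1)] unfolding linked_def by blast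
  qed
qed

lemma ball_subset_graph_ball:
  assumes G: "pair_bidirected_digraph G" and g: "connected_lf_graph (pverts G) (parcs G)"
    and v: "v \<in> pverts G"
  shows "connected_lf_graph.ball (parcs G) v n \<subseteq> graph_ball G v n"
proof -
  interpret pair_bidirected_digraph G by fact
  interpret g: connected_lf_graph "pverts G" "parcs G" by fact
  have "\<exists>p. awalk v p u \<and> length p \<le> n" if "u \<in> g.ball v n" for u n
    using that
  proof (induction n arbitrary: u)
    case 0
    then show ?case using v by (auto intro: exI[of _ "[]"] simp: awalk_Nil_iff)
  next
    case (Suc n)
    show ?case
    proof (cases "u \<in> g.ball v n")
      case True
      then show ?thesis using Suc.IH le_SucI by blast
    next
      case False
      then obtain w where w: "w \<in> g.ball v n" "(w, u) \<in> parcs G"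
        using Suc.prems by auto
      obtain p where p: "awalk v p w" "length p \<le> n" using Suc.IH w(1) by blast
      have "awalk w [(w, u)] u" using arc_implies_awalk[OF w(2)] by simp
      with p(1) have "awalk v (p @ [(w, u)]) u" by (rule awalk_appendI)
      then show ?thesis using p(2) by (intro exI[of _ "p @ [(w, u)]"]) simp
    qed
  qed
  then show ?thesis
    using graph_ball_conv_awalk[OF pair_wf_digraph_axioms v] by blast
qed

theorem theorem4p4:
  fixes G :: "'a pair_pre_digraph"
  assumes "pair_bidirected_digraph G"
    and "Digraph_Component.connected (with_proj G)"
    and "locally_finite G"
    and "card (graph_ends G) = 1"
    and "linear_growth G"
  shows "finite (carrier (GraphAutGroup G)) \<or>
         carrier (GraphAutGroup G) \<approx> (UNIV :: nat set set)"
proof -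
  interpret g: one_ended_graph "pverts G" "parcs G"
    by (rule one_ended_graph_pverts) fact+
  have carrier: "carrier (GraphAutGroup G) = g.auts"
    by (simp add: GraphAutGroup_def graph_auts_def g.auts_def)
  show ?thesis
  proof (cases "\<exists>S. finite S \<and> S \<subseteq> pverts G \<and>
      (\<forall>f \<in> g.auts. (\<forall>s \<in> S. f s = s) \<longrightarrow> f = (\<lambda>x\<in>pverts G. x))")
    case True
    then obtain S where S: "finite S" "S \<subseteq> pverts G"
      and triv: "\<forall>f \<in> g.auts. (\<forall>s \<in> S. f s = s) \<longrightarrow> f = (\<lambda>x\<in>pverts G. x)"
      by blast
    obtain v c where v: "v \<in> pverts G"
      and growth: "\<And>n. n \<ge> 1 \<Longrightarrow> finite (graph_ball G v n) \<and> real (card (graph_ball G v n)) \<le> c * real n"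
      using assms(5) by (auto simp: linear_growth_def)
    have card: "card (g.ball v n) \<le> nat \<lceil>c\<rceil> * n" if "n \<ge> 1" for n
    proof -
      have "card (g.ball v n) \<le> card (graph_ball G v n)"
        using growth[OF that] ball_subset_graph_ball[OF assms(1) g.connected_lf_graph_axioms v]
        by (intro card_mono) auto
      then have "real (card (g.ball v n)) \<le> c * real n"
        using growth[OF that] by linarith
      also have "\<dots> \<le> real (nat \<lceil>c\<rceil>) * real n"
        by (intro mult_right_mono) linarith+
      finally show ?thesis by (simp flip: of_nat_mult)
    qed
    have "finite g.auts"
    proof (rule g.finite_auts_if_trivial_stabilizer[OF _ S])
      show "\<exists>D. finite D \<and> T \<subseteq> D \<and> D \<subseteq> pverts G \<and> card (g.boundary D) \<le> nat \<lceil>c\<rceil>"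
        if "finite T" "T \<subseteq> pverts G" for T
        using g.linear_growth_imp_bounded_cuts[OF v card that] .
    qed (use triv in blast)
    then show ?thesis using carrier by simp
  next
    case False
    have "\<exists>f \<in> g.auts. (\<forall>s \<in> S. f s = s) \<and> f \<noteq> (\<lambda>x\<in>pverts G. x)"
      if "finite S" "S \<subseteq> pverts G" for S
      using False that by blast
    then have "(UNIV :: nat set set) \<lesssim> g.auts"
      by (rule g.nat_sets_lepoll_auts)
    then show ?thesis
      unfolding carrier using lepoll_antisym[OF g.auts_lepoll] by blast
  qed
qed

end
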